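(* Let $d\ge1$, $L>0$, $\delta\in(0,1)$, $h\in\left[0,\frac{2}{1+\delta}\right]$ and $N\in\mathbb{N}$. There exist a convex $L$-smooth function $f:\mathbb{R}^d\to\mathbb{R}$ with a minimizer $x_\ast$, an initial point $x_0$ with $f(x_0)>f(x_\ast)$, and iterates $x_1,\dots,x_N$ generated from $x_0$ by $N$ steps of relatively inexact gradient descent with constant normalized stepsize $h$ and relative inexactness $\delta$ (for some admissible choice of the inexact gradients), such that $$\max\left\{\frac{1}{Nh(1-\delta)+\frac12},\;2(1-h(1+\delta))^{2N}\right\}\bigl(f(x_0)-f(x_\ast)\bigr)\le\frac1L\|\nabla f(x_N)\|^2.$$
   Context: $\|\cdot\|$ is the Euclidean norm. A differentiable function $f:\mathbb{R}^d\to\mathbb{R}$ is $L$-smooth if $\|\nabla f(x)-\nabla f(y)\|\le L\|x-y\|$ for all $x,y$. Relatively inexact gradient descent with constant normalized stepsize $h$ and relative inexactness $\delta$: starting from $x_0$, for $k=0,1,2,\dots$, a vector $d_k\in\mathbb{R}^d$ satisfying $\|d_k-\nabla f(x_k)\|\le\delta\|\nabla f(x_k)\|$ (an admissible inexact gradient) is used, and $x_{k+1}=x_k-\frac{h}{L}d_k$. *)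

theory Defs
  imports "HOL-Analysis.Analysis"
begin

text \<open>Only meaningful where \<open>f\<close> is differentiable; see \<open>GDERIV_grad\<close> below.\<close>

definition grad :: "('a::euclidean_space \<Rightarrow> real) \<Rightarrow> 'a \<Rightarrow> 'a" where
  "grad f x = (THE D. GDERIV f x :> D)"

lemma grad_eqI:
  assumes "GDERIV f x :> D"
  shows "grad f x = D"
  unfolding grad_def
proof (rule the_equality)
  show "GDERIV f x :> D" by fact
next
  fix E assume "GDERIV f x :> E"
  with assms have "(\<lambda>h. inner h E) = (\<lambda>h. inner h D)"
    unfolding gderiv_def by (rule has_derivative_unique[rotated])
  then have "inner (E - D) E = inner (E - D) D" by metis
  then have "inner (E - D) (E - D) = 0" by (simp add: inner_diff_right)
  then show "E = D" by simp
qed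

lemma GDERIV_grad:
  assumes "f differentiable (at x)"
  shows "GDERIV f x :> grad f x"
proof -
  obtain f' where f': "(f has_derivative f') (at x)"
    using assms by (auto simp: differentiable_def)
  interpret bounded_linear f' by (rule has_derivative_bounded_linear[OF f'])
  have "f' = (\<lambda>h. inner h (\<Sum>b\<in>Basis. f' b *\<^sub>R b))"
  proof
    fix h
    have "f' h = f' (\<Sum>b\<in>Basis. inner h b *\<^sub>R b)" by (simp add: euclidean_representation)
    also have "\<dots> = inner h (\<Sum>b\<in>Basis. f' b *\<^sub>R b)"
      by (simp add: sum scale inner_sum_right mult.commute)
    finally show "f' h = inner h (\<Sum>b\<in>Basis. f' b *\<^sub>R b)" .
  qed
  then have "GDERIV f x :> (\<Sum>b\<in>Basis. f' b *\<^sub>R b)"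
    using f' unfolding gderiv_def by simp
  then show ?thesis by (simp add: grad_eqI)
qed

definition L_smooth :: "real \<Rightarrow> ('a::euclidean_space \<Rightarrow> real) \<Rightarrow> bool" where
  "L_smooth L f \<longleftrightarrow>
     (\<forall>x. f differentiable (at x)) \<and>
     (\<forall>x y. norm (grad f x - grad f y) \<le> L * norm (x - y))"

definition admissible_inexact_gradient ::
    "real \<Rightarrow> ('a::euclidean_space \<Rightarrow> real) \<Rightarrow> 'a \<Rightarrow> 'a \<Rightarrow> bool" where
  "admissible_inexact_gradient \<delta> f x d \<longleftrightarrow> norm (d - grad f x) \<le> \<delta> * norm (grad f x)"

text \<open>Only the entries \<open>x 0, \<dots>, x N\<close> of the sequence are constrained.\<close>

definition inexact_gd_iterates ::
    "real \<Rightarrow> real \<Rightarrow> real \<Rightarrow> ('a::euclidean_space \<Rightarrow> real) \<Rightarrow> nat \<Rightarrow> (nat \<Rightarrow> 'a) \<Rightarrow> bool" where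
  "inexact_gd_iterates L h \<delta> f N x \<longleftrightarrow>
     (\<forall>k<N. \<exists>d. admissible_inexact_gradient \<delta> f (x k) d \<and>
                  x (Suc k) = x k - (h / L) *\<^sub>R d)"

end

theory Submission
  imports Defs
begin

text \<open>
  Both terms of the maximum are attained by functions of a single coordinate. For the quadratic
  \<open>L t\<^sup>2 / 2\<close> the inexact gradient overestimates the gradient by the factor \<open>1 + \<delta>\<close>, so every step
  multiplies the iterate by \<open>1 - h (1 + \<delta>)\<close>. For the one-sided Huber function, which continues
  \<open>L t\<^sup>2 / 2\<close> linearly beyond \<open>t = 1\<close>, the inexact gradient underestimates the gradient by the factor
  \<open>1 - \<delta>\<close>; started at \<open>1 + N h (1 - \<delta>)\<close>, the method moves along the linear piece by constant
  steps and arrives at the kink \<open>t = 1\<close> exactly at step \<open>N\<close>.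
\<close>

lemma GDERIV_ridge:
  fixes u :: "'a::euclidean_space"
  assumes "(\<phi> has_real_derivative D) (at (inner x u))"
  shows "GDERIV (\<lambda>x. \<phi> (inner x u)) x :> D *\<^sub>R u"
proof -
  have "((\<lambda>x. \<phi> (inner x u)) has_derivative (\<lambda>h. D * inner h u)) (at x)"
    by (rule has_derivative_compose[where f = "\<lambda>x. inner x u" and g = \<phi>, simplified])
      (use assms in \<open>auto intro!: derivative_eq_intros simp: has_field_derivative_def\<close>)
  then show ?thesis
    by (simp add: gderiv_def)
qed

lemma convex_on_ridge:
  fixes u :: "'a::real_inner"
  assumes "convex_on UNIV \<phi>"
  shows "convex_on UNIV (\<lambda>x. \<phi> (inner x u))"
  using assms by (simp add: convex_on_def inner_add_left)

text \<open>All gradients are multiples of the unit vector \<open>u\<close>, so a gradient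
  difference has the size of the scalar difference of \<open>\<phi>'\<close>. By Cauchy-Schwarz the
  projection onto \<open>u\<close> does not expand distances, so the constant \<open>L\<close>
  survives.\<close>

lemma L_smooth_ridge:
  fixes u :: "'a::euclidean_space"
  assumes deriv: "\<And>t. (\<phi> has_real_derivative \<phi>' t) (at t)"
    and lip: "\<And>s t. \<bar>\<phi>' s - \<phi>' t\<bar> \<le> L * \<bar>s - t\<bar>"
    and "L \<ge> 0" and u: "norm u = 1"
  shows "L_smooth L (\<lambda>x. \<phi> (inner x u))"
  unfolding L_smooth_def
proof (intro conjI allI)
  fix x y :: 'a
  note G = GDERIV_ridge[where u = u, OF deriv]
  show "(\<lambda>x. \<phi> (inner x u)) differentiable (at x)"
    using G[of x] by (auto simp: gderiv_def differentiable_def)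
  have "norm (\<phi>' (inner x u) *\<^sub>R u - \<phi>' (inner y u) *\<^sub>R u)
      = \<bar>\<phi>' (inner x u) - \<phi>' (inner y u)\<bar>"
    using u by (simp flip: scaleR_diff_left)
  also have "\<dots> \<le> L * \<bar>inner (x - y) u\<bar>"
    using lip by (simp add: inner_diff_left)
  also have "\<dots> \<le> L * norm (x - y)"
    using Cauchy_Schwarz_ineq2[of "x - y" u] u \<open>L \<ge> 0\<close> by (intro mult_left_mono) auto
  finally show "norm (grad (\<lambda>x. \<phi> (inner x u)) x - grad (\<lambda>x. \<phi> (inner x u)) y)
      \<le> L * norm (x - y)"
    by (simp add: grad_eqI[OF G])
qed

text \<open>Scaling the exact gradient by \<open>1 + s\<close> causes relative error
  \<open>\<bar>s\<bar>\<close> and keeps the iterates on the line spanned by \<open>u\<close>. The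
  method thus becomes the scalar recursion for \<open>t\<close>; the sign of \<open>s\<close>
  decides between over- and underestimation.\<close>

lemma inexact_gd_iterates_ridge:
  fixes u :: "'a::euclidean_space"
  assumes deriv: "\<And>t. (\<phi> has_real_derivative \<phi>' t) (at t)"
    and u: "norm u = 1" and s: "\<bar>s\<bar> \<le> \<delta>"
    and step: "\<And>k. k < N \<Longrightarrow> t (Suc k) = t k - h / L * ((1 + s) * \<phi>' (t k))"
  shows "inexact_gd_iterates L h \<delta> (\<lambda>x. \<phi> (inner x u)) N (\<lambda>k. t k *\<^sub>R u)"
  unfolding inexact_gd_iterates_def
proof (intro allI impI exI conjI)
  fix k assume "k < N"
  have "inner u u = 1"
    using u by (simp add: norm_eq_1)
  then have g: "grad (\<lambda>x. \<phi> (inner x u)) (t k *\<^sub>R u) = \<phi>' (t k) *\<^sub>R u"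
    using grad_eqI[OF GDERIV_ridge[where \<phi> = \<phi> and x = "t k *\<^sub>R u", OF deriv]] by simp
  have "((1 + s) * \<phi>' (t k)) *\<^sub>R u - \<phi>' (t k) *\<^sub>R u = (s * \<phi>' (t k)) *\<^sub>R u"
    by (simp add: algebra_simps)
  then show "admissible_inexact_gradient \<delta> (\<lambda>x. \<phi> (inner x u)) (t k *\<^sub>R u)
      (((1 + s) * \<phi>' (t k)) *\<^sub>R u)"
    using s u unfolding admissible_inexact_gradient_def g
    by (simp add: abs_mult mult_right_mono)
  show "t (Suc k) *\<^sub>R u = t k *\<^sub>R u - (h / L) *\<^sub>R (((1 + s) * \<phi>' (t k)) *\<^sub>R u)"
    by (simp only: step[OF \<open>k < N\<close>] scaleR_left_diff_distrib scaleR_scaleR)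
qed

text \<open>Reduction to one dimension: \<open>\<phi>\<close> is lifted along a unit vector, with
  the origin as minimizer and convexity coming from the monotone derivative. The factor
  \<open>C\<close> is left free so that either term of the maximum can be inserted.\<close>

lemma inexact_gd_instance_from_line:
  fixes \<phi> \<phi>' :: "real \<Rightarrow> real"
  assumes deriv: "\<And>t. (\<phi> has_real_derivative \<phi>' t) (at t)"
    and mono: "\<And>s t. s \<le> t \<Longrightarrow> \<phi>' s \<le> \<phi>' t"
    and lip: "\<And>s t. \<bar>\<phi>' s - \<phi>' t\<bar> \<le> L * \<bar>s - t\<bar>"
    and L: "L \<ge> 0"
    and min: "\<And>s. \<phi> 0 \<le> \<phi> s"
    and start: "\<phi> (t 0) > \<phi> 0"
    and s: "\<bar>s\<bar> \<le> \<delta>"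
    and step: "\<And>k. k < N \<Longrightarrow> t (Suc k) = t k - h / L * ((1 + s) * \<phi>' (t k))"
    and bound: "C * (\<phi> (t 0) - \<phi> 0) \<le> 1 / L * (\<phi>' (t N))\<^sup>2"
  shows "\<exists>(f :: 'a::euclidean_space \<Rightarrow> real) (x_star :: 'a) (x :: nat \<Rightarrow> 'a).
           convex_on UNIV f \<and> L_smooth L f \<and>
           (\<forall>y. f x_star \<le> f y) \<and>
           f (x 0) > f x_star \<and>
           inexact_gd_iterates L h \<delta> f N x \<and>
           C * (f (x 0) - f x_star) \<le> 1 / L * (norm (grad f (x N)))\<^sup>2"
proof -
  obtain u :: 'a where u: "norm u = 1"
    using vector_choose_size[of 1] by auto
  then have uu: "inner u u = 1"
    by (simp add: norm_eq_1)
  define f where "f = (\<lambda>x. \<phi> (inner x u))"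
  have "convex_on UNIV \<phi>"
    by (rule convex_on_realI[where f' = \<phi>']) (auto intro: deriv mono)
  then have "convex_on UNIV f"
    unfolding f_def by (rule convex_on_ridge)
  moreover have "L_smooth L f"
    unfolding f_def by (rule L_smooth_ridge[OF deriv lip L u])
  moreover have "inexact_gd_iterates L h \<delta> f N (\<lambda>k. t k *\<^sub>R u)"
    unfolding f_def by (rule inexact_gd_iterates_ridge[where \<phi> = \<phi> and \<phi>' = \<phi>' and t = t and s = s])
      (use deriv u s step in auto)
  moreover have "grad f (t N *\<^sub>R u) = \<phi>' (t N) *\<^sub>R u"
    using grad_eqI[OF GDERIV_ridge[where \<phi> = \<phi> and x = "t N *\<^sub>R u", OF deriv]] uu by (simp add: f_def)
  moreover have "f (t k *\<^sub>R u) = \<phi> (t k)" "f 0 = \<phi> 0" "\<phi> 0 \<le> f y" for k y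
    using uu min by (simp_all add: f_def)
  ultimately show ?thesis
    using start bound u
    by (intro exI[of _ f] exI[of _ "0::'a"] exI[of _ "\<lambda>k. t k *\<^sub>R u"]) simp
qed

definition huber :: "real \<Rightarrow> real" where
  "huber t = (if t \<le> 1 then t\<^sup>2 / 2 else t - 1 / 2)"

lemma huber_has_derivative: "(huber has_real_derivative min t 1) (at t)"
proof -
  \<comment> \<open>The closures of the two pieces meet only at 1, where values
    (\<open>1 / 2\<close>) and slopes (1) agree, so the pieces glue differentiably.\<close>
  have "((\<lambda>t. if t \<in> {..1} then t\<^sup>2 / 2 else t - 1 / 2) has_vector_derivative
      (if t \<in> {..1} then t else 1)) (at t within UNIV)"
    by (rule has_vector_derivative_If_within_closures[where T = "{1<..}"])
      (auto intro!: derivative_eq_intros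
        simp flip: has_real_derivative_iff_has_vector_derivative)
  then show ?thesis
    by (simp add: huber_def[abs_def] has_real_derivative_iff_has_vector_derivative min_def)
qed

lemma huber_nonneg: "huber t \<ge> 0"
  by (simp add: huber_def)

theorem theorem3p2:
  fixes L \<delta> h :: real and N :: nat
  assumes "L > 0"
    and "0 < \<delta>" and "\<delta> < 1"
    and "0 \<le> h" and "h \<le> 2 / (1 + \<delta>)"
  shows "\<exists>(f :: real ^ 'n \<Rightarrow> real) (x_star :: real ^ 'n) (x :: nat \<Rightarrow> real ^ 'n).
           convex_on UNIV f \<and> L_smooth L f \<and>
           (\<forall>y. f x_star \<le> f y) \<and>
           f (x 0) > f x_star \<and>
           inexact_gd_iterates L h \<delta> f N x \<and>
           max (1 / (real N * h * (1 - \<delta>) + 1 / 2)) (2 * (1 - h * (1 + \<delta>)) ^ (2 * N))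
             * (f (x 0) - f x_star)
           \<le> 1 / L * (norm (grad f (x N)))\<^sup>2"
proof (cases "2 * (1 - h * (1 + \<delta>)) ^ (2 * N) \<le> 1 / (real N * h * (1 - \<delta>) + 1 / 2)")
  case True
  \<comment> \<open>Closed form of the iterates, fixed backwards from \<open>t N = 1\<close>: the
    last gradient still has full slope, while the starting value is as small as possible on the
    linear piece.\<close>
  define t where "t k = 1 + (real N - real k) * (h * (1 - \<delta>))" for k
  have h: "0 \<le> h * (1 - \<delta>)"
    using assms by simp
  have ge1: "1 \<le> t k" if "k \<le> N" for k
    using h that by (simp add: t_def)
  \<comment> \<open>The initial gap is the reciprocal of the first term of the maximum, so the final
    bound holds with equality, both sides being \<open>L\<close>. If \<open>t 0 = 1\<close>, the
    quadratic branch gives the same value.\<close>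
  have t0: "huber (t 0) = real N * h * (1 - \<delta>) + 1 / 2"
    using ge1[of 0] by (auto simp: huber_def t_def)
  have pos: "real N * h * (1 - \<delta>) + 1 / 2 > 0"
    using h by (simp add: add_nonneg_pos mult.assoc)
  show ?thesis
    unfolding max_absorb1[OF True]
  proof (rule inexact_gd_instance_from_line
      [where \<phi> = "\<lambda>t. L * huber t" and \<phi>' = "\<lambda>t. L * min t 1" and s = "-\<delta>" and t = t])
    show "((\<lambda>t. L * huber t) has_real_derivative L * min t 1) (at t)" for t
      by (rule DERIV_cmult[OF huber_has_derivative])
    show "L * min s 1 \<le> L * min t 1" if "s \<le> t" for s t
      using that \<open>L > 0\<close> by (intro mult_left_mono) auto
    have "\<bar>min s 1 - min t 1\<bar> \<le> \<bar>s - t\<bar>" for s t :: real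
      by auto
    then show "\<bar>L * min s 1 - L * min t 1\<bar> \<le> L * \<bar>s - t\<bar>" for s t
      using \<open>L > 0\<close> by (simp add: abs_mult flip: right_diff_distrib)
    show "L * huber 0 \<le> L * huber s" for s
      using \<open>L > 0\<close> huber_nonneg[of s] by (simp add: huber_def[of 0])
    show "L * huber 0 < L * huber (t 0)"
      using \<open>L > 0\<close> pos unfolding t0 by (simp add: huber_def)
    \<comment> \<open>By \<open>ge1\<close> the slope at \<open>t k\<close> is 1, so each step
      subtracts exactly \<open>h * (1 - \<delta>)\<close>.\<close>
    show "t (Suc k) = t k - h / L * ((1 + - \<delta>) * (L * min (t k) 1))" if "k < N" for k
      using ge1[of k] that \<open>L > 0\<close> by (simp add: t_def algebra_simps)
    show "1 / (real N * h * (1 - \<delta>) + 1 / 2) * (L * huber (t 0) - L * huber 0)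
        \<le> 1 / L * (L * min (t N) 1)\<^sup>2"
      using \<open>L > 0\<close> pos unfolding t0 by (simp add: huber_def t_def power2_eq_square)
  qed (use assms in auto)
next
  case False
  define t where "t k = (1 - h * (1 + \<delta>)) ^ k" for k
  show ?thesis
    unfolding max_absorb2[OF less_imp_le[OF False[unfolded not_le]]]
  proof (rule inexact_gd_instance_from_line
      [where \<phi> = "\<lambda>t. L * (t\<^sup>2 / 2)" and \<phi>' = "\<lambda>t. L * t" and s = \<delta> and t = t])
    show "((\<lambda>t. L * (t\<^sup>2 / 2)) has_real_derivative L * t) (at t)" for t
      by (auto intro!: derivative_eq_intros)
    show "\<bar>L * s - L * t\<bar> \<le> L * \<bar>s - t\<bar>" for s t
      using \<open>L > 0\<close> by (simp add: abs_mult flip: right_diff_distrib)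
    show "t (Suc k) = t k - h / L * ((1 + \<delta>) * (L * t k))" for k
      using \<open>L > 0\<close> by (simp add: t_def algebra_simps)
    \<comment> \<open>Equality again: since \<open>t 0 = 1\<close>, both sides are
      \<open>L * (t N)\<^sup>2\<close>.\<close>
    show "2 * (1 - h * (1 + \<delta>)) ^ (2 * N) * (L * ((t 0)\<^sup>2 / 2) - L * (0\<^sup>2 / 2))
        \<le> 1 / L * (L * t N)\<^sup>2"
      using \<open>L > 0\<close> by (simp add: t_def power2_eq_square power_even_eq)
  qed (use assms in \<open>auto simp: t_def\<close>)
qed

end
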